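(* Let $P,Q\in\mathbb{Z}[x]$ be two polynomials of degree at most $3$ and let $\mathcal{F}_k: y^2=P(x)k+Q(x)$. For every prime power $q$ we have $$\#M(\mathbb{F}_q)=q^3+q^2+\tilde{M}_{2,q}(\mathcal{F}_k).$$
   Context: For $q=p^r$ the polynomials are reduced mod $p$. For $k\in\mathbb{F}_q$ let $a_{k,q}=q-\#\{(x,y)\in\mathbb{F}_q^2: y^2=P(x)k+Q(x)\}$ and $a_{\infty,q}=q-\#\{(x,y)\in\mathbb{F}_q^2: y^2=P(x)\}$; $\tilde{M}_{2,q}(\mathcal{F}_k)=\sum_{k\in\mathbb{F}_q}a_{k,q}^2+a_{\infty,q}^2$. The threefold $M$ is the union of $M_{aff}:(P(x_1)k+Q(x_1))(P(x_2)k+Q(x_2))=y^2$ in $\mathbb{A}^4_{x_1,x_2,k,y}$ (placed over $(k:1)\in\mathbb{P}^1$) and $M_\infty: P(x_1)P(x_2)=y^2$ in $\mathbb{A}^3_{x_1,x_2,y}$ (placed over $(1:0)\in\mathbb{P}^1$), inside $\mathbb{A}^1\times\mathbb{A}^1\times\mathbb{P}^1\times\mathbb{A}^1$; thus $\#M(\mathbb{F}_q)=\#\{(x_1,x_2,k,y)\in\mathbb{F}_q^4:(P(x_1)k+Q(x_1))(P(x_2)k+Q(x_2))=y^2\}+\#\{(x_1,x_2,y)\in\mathbb{F}_q^3:P(x_1)P(x_2)=y^2\}$. *)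

theory Defs
  imports "HOL-Library.Cardinality" "HOL-Computational_Algebra.Computational_Algebra"
begin

abbreviation reduce :: "int poly \<Rightarrow> 'k::comm_ring_1 poly" where
  "reduce \<equiv> map_poly of_int"

text \<open>In the definitions below \<open>P\<close>, \<open>Q\<close> are the already reduced polynomials, over a field type
  \<open>'k\<close> that plays the role of \<open>F\<^sub>q\<close>, with \<open>q = CARD('k)\<close>.\<close>

definition a_coeff :: "'k::{field,finite} poly \<Rightarrow> 'k poly \<Rightarrow> 'k \<Rightarrow> int" where
  "a_coeff P Q k = int CARD('k) - int (card {(x::'k, y). y ^ 2 = poly P x * k + poly Q x})"

definition a_infty :: "'k::{field,finite} poly \<Rightarrow> int" where
  "a_infty P = int CARD('k) - int (card {(x::'k, y). y ^ 2 = poly P x})"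

definition M2_tilde :: "'k::{field,finite} poly \<Rightarrow> 'k poly \<Rightarrow> int" where
  "M2_tilde P Q = (\<Sum>k\<in>UNIV. (a_coeff P Q k) ^ 2) + (a_infty P) ^ 2"

text \<open>The point \<open>(a : b)\<close> of the projective line, as the class of all nonzero multiples of
  \<open>(a, b)\<close>; meaningful for \<open>(a, b) \<noteq> (0, 0)\<close>.\<close>

definition proj_point :: "'k::field \<Rightarrow> 'k \<Rightarrow> ('k \<times> 'k) set" where
  "proj_point a b = {(c * a, c * b) | c. c \<noteq> 0}"

text \<open>The rational points of the threefold, as quadruples
  \<open>(x\<^sub>1, x\<^sub>2, \<kappa>, y)\<close> with \<open>\<kappa>\<close> on the projective line.\<close>

definition M_aff :: "'k::field poly \<Rightarrow> 'k poly \<Rightarrow> ('k \<times> 'k \<times> ('k \<times> 'k) set \<times> 'k) set" where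
  "M_aff P Q = {(x1, x2, proj_point k 1, y) | x1 x2 k y.
     (poly P x1 * k + poly Q x1) * (poly P x2 * k + poly Q x2) = y ^ 2}"

definition M_infty :: "'k::field poly \<Rightarrow> ('k \<times> 'k \<times> ('k \<times> 'k) set \<times> 'k) set" where
  "M_infty P = {(x1, x2, proj_point 1 0, y) | x1 x2 y. poly P x1 * poly P x2 = y ^ 2}"

definition M_points :: "'k::field poly \<Rightarrow> 'k poly \<Rightarrow> ('k \<times> 'k \<times> ('k \<times> 'k) set \<times> 'k) set" where
  "M_points P Q = M_aff P Q \<union> M_infty P"

end

theory Submission
  imports Defs
begin

text \<open>Write the number of square roots of \<open>c\<close> as \<open>1 + \<chi> c\<close>. The function \<open>\<chi>\<close> is multiplicative:
  it is the quadratic character in odd characteristic and vanishes identically in characteristic 2.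
  Hence the surface \<open>f x\<^sub>1 * f x\<^sub>2 = y\<^sup>2\<close> has \<open>q\<^sup>2 + (\<Sum>x. \<chi> (f x))\<^sup>2\<close> points, while the curve
  \<open>y\<^sup>2 = f x\<close> has \<open>q + (\<Sum>x. \<chi> (f x))\<close>; summing over the fibres above the projective line gives the
  claim.\<close>

definition sqroots :: "'k::field \<Rightarrow> 'k set" where
  "sqroots c = {y. y ^ 2 = c}"

definition quad_char :: "'k::{field,finite} \<Rightarrow> int" where
  "quad_char c = int (card (sqroots c)) - 1"

lemma sqroots_power2: "sqroots (d ^ 2) = {d, - d :: 'k::field}"
  by (auto simp: sqroots_def power2_eq_iff)

lemma card_sqroots_le_2: "card (sqroots (c :: 'k::{field,finite})) \<le> 2"
proof (cases "sqroots c = {}")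
  case False
  then obtain d where "c = d ^ 2" by (auto simp: sqroots_def)
  then show ?thesis by (simp add: sqroots_power2 card_insert_if)
qed simp

lemma card_curve:
  "card {(x, y). y ^ 2 = f x} = (\<Sum>x\<in>UNIV. card (sqroots (f x)))"
  for f :: "'a::finite \<Rightarrow> 'k::{field,finite}"
proof -
  have "{(x, y). y ^ 2 = f x} = Sigma UNIV (\<lambda>x. sqroots (f x))"
    by (auto simp: sqroots_def)
  then show ?thesis by simp
qed

text \<open>Each \<open>y\<close> is a square root of exactly one element, so the pairs
  \<open>(c, y)\<close> are counted by \<open>y\<close> alone.\<close>

lemma sum_card_sqroots: "(\<Sum>c\<in>UNIV. card (sqroots (c :: 'k))) = CARD('k::{field,finite})"
proof -
  have "{(c :: 'k, y). y ^ 2 = c} = (\<lambda>y. (y ^ 2, y)) ` UNIV" by auto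
  then have "card {(c :: 'k, y). y ^ 2 = c} = CARD('k)"
    by (simp add: card_image inj_on_def)
  then show ?thesis using card_curve[of "\<lambda>c :: 'k. c"] by simp
qed

lemma card_sqroots_power2_mult:
  assumes "d \<noteq> 0"
  shows "card (sqroots (d ^ 2 * c)) = card (sqroots (c :: 'k::{field,finite}))"
proof -
  have "sqroots (d ^ 2 * c) = (\<lambda>y. d * y) ` sqroots c"
  proof (intro set_eqI iffI)
    fix y assume "y \<in> sqroots (d ^ 2 * c)"
    then have "y / d \<in> sqroots c" "y = d * (y / d)"
      using assms by (auto simp: sqroots_def power_divide)
    then show "y \<in> (\<lambda>y. d * y) ` sqroots c" by blast
  qed (auto simp: sqroots_def power_mult_distrib)
  then show ?thesis using assms by (simp add: card_image inj_on_def)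
qed

text \<open>The summands below are at most 2 and sum to \<open>2 * q\<close>, so all of them equal 2.\<close>

lemma card_sqroots_nonsquare_mult:
  assumes b: "sqroots (b :: 'k::{field,finite}) = {}"
  shows "card (sqroots c) + card (sqroots (b * c)) = 2"
proof -
  let ?g = "\<lambda>c. card (sqroots c) + card (sqroots (b * c))"
  have b0: "b \<noteq> 0" using b by (auto simp: sqroots_def)
  have le: "?g c \<le> 2" for c
  proof (cases "c = 0")
    case True
    then show ?thesis by (simp add: sqroots_def)
  next
    \<comment> \<open>If \<open>c = d ^ 2\<close> with \<open>d\<close> nonzero, then
      \<open>b * c\<close> has as many roots as \<open>b\<close>, that is, none; so at most one of
      the two summands is nonzero.\<close>
    case False
    show ?thesis
    proof (cases "sqroots c = {}")
      case True
      then show ?thesis using card_sqroots_le_2[of "b * c"] by simp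
    next
      case nonempty: False
      then obtain d where d: "c = d ^ 2" by (auto simp: sqroots_def)
      then have "card (sqroots (b * c)) = 0"
        using False b card_sqroots_power2_mult[of d b] by (simp add: mult.commute)
      then show ?thesis using card_sqroots_le_2[of c] by simp
    qed
  qed
  \<comment> \<open>Multiplication by \<open>b\<close> permutes the field, so both summands of
    \<open>?g\<close> have the same total, namely q.\<close>
  have "bij ((*) b)"
    using b0 by (intro bij_betw_byWitness[where f' = "\<lambda>x. x / b"]) auto
  then have "(\<Sum>c\<in>UNIV. card (sqroots (b * c))) = (\<Sum>c\<in>UNIV. card (sqroots (c :: 'k)))"
    by (rule sum.reindex_bij_betw)
  then have "(\<Sum>c\<in>UNIV. ?g c) = (\<Sum>c\<in>(UNIV :: 'k set). 2)"
    by (simp add: sum.distrib sum_card_sqroots)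
  then show ?thesis
    using sum_strict_mono_ex1[of UNIV ?g "\<lambda>_. 2"] le
    by (metis UNIV_I finite less_irrefl order_le_less)
qed

text \<open>A nonsquare factor flips the sign by \<open>card_sqroots_nonsquare_mult\<close>; a
  nonzero square factor preserves the value, which leaves only characteristic 2 to be treated
  separately.\<close>

lemma quad_char_mult: "quad_char (a * b) = quad_char a * quad_char (b :: 'k::{field,finite})"
proof (cases "sqroots a = {}")
  case True
  then show ?thesis
    using card_sqroots_nonsquare_mult[OF True, of b] by (simp add: quad_char_def)
next
  case False
  then obtain d where d: "a = d ^ 2" by (auto simp: sqroots_def)
  show ?thesis
  proof (cases "d = 0")
    case True
    then show ?thesis using d by (simp add: quad_char_def sqroots_def)
  next
    case d0: False
    have ab: "quad_char (a * b) = quad_char b"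
      using card_sqroots_power2_mult[OF d0, of b] d by (simp add: quad_char_def)
    show ?thesis
    proof (cases "d = - d")
      case False
      then have "quad_char a = 1" by (simp add: quad_char_def d sqroots_power2)
      then show ?thesis using ab by simp
    next
      case True
      then have "(2 :: 'k) * d = 0" by (metis add.right_inverse mult_2)
      then have "(2 :: 'k) = 0" using d0 by simp
      then have neg: "- y = y" for y :: 'k
        by (metis add_eq_0_iff mult_2 mult_zero_left)
      \<comment> \<open>In characteristic 2 the element 1 has a single root, so a nonsquare
        \<open>b\<close> would give the total 1 + 0 instead of 2. Hence every \<open>b\<close> is a
        square, with exactly one root.\<close>
      have "sqroots (1 :: 'k) = {1}"
        using sqroots_power2[of "1 :: 'k"] neg[of 1] by simp
      then have "sqroots b \<noteq> {}"
        using card_sqroots_nonsquare_mult[of b 1] by auto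
      then obtain e where "b = e ^ 2" by (auto simp: sqroots_def)
      then have "quad_char b = 0" by (simp add: quad_char_def sqroots_power2 neg)
      then show ?thesis using ab by simp
    qed
  qed
qed

text \<open>The index type \<open>'a\<close> is independent of the field so that pairs
  \<open>(x1, x2)\<close> can also serve as base points.\<close>

lemma card_curve_quad_char:
  "int (card {(x, y). y ^ 2 = f x}) = int CARD('a) + (\<Sum>x\<in>UNIV. quad_char (f x))"
  for f :: "'a::finite \<Rightarrow> 'k::{field,finite}"
  by (simp add: card_curve quad_char_def sum_subtractf)

text \<open>By multiplicativity the double character sum is the square of a single one. That sum is
  minus the trace of the curve, and squaring removes the sign.\<close>

lemma card_surface:
  "int (card {(x1, x2, y). f x1 * f x2 = y ^ 2}) =
    int CARD('a) ^ 2 + (int CARD('a) - int (card {(x, y). y ^ 2 = f x})) ^ 2"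
  for f :: "'a::finite \<Rightarrow> 'k::{field,finite}"
proof -
  have "{(x1, x2, y). f x1 * f x2 = y ^ 2} =
      (\<lambda>((x1, x2), y). (x1, x2, y)) ` {(x, y). y ^ 2 = (case x of (x1, x2) \<Rightarrow> f x1 * f x2)}"
    by (force simp: image_iff)
  then have "card {(x1, x2, y). f x1 * f x2 = y ^ 2} =
      card {(x, y). y ^ 2 = (case x of (x1, x2) \<Rightarrow> f x1 * f x2)}"
    by (simp add: card_image inj_on_def split_beta prod_eq_iff)
  also have "int \<dots> = int CARD('a) ^ 2 + (\<Sum>x1\<in>UNIV. \<Sum>x2\<in>UNIV. quad_char (f x1 * f x2))"
    unfolding card_curve_quad_char
    by (simp add: sum.cartesian_product split_beta power2_eq_square)
  also have "\<dots> = int CARD('a) ^ 2 + (\<Sum>x\<in>UNIV. quad_char (f x)) ^ 2"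
    by (simp add: quad_char_mult power2_eq_square sum_product)
  finally show ?thesis by (simp add: card_curve_quad_char)
qed

lemma proj_point_finite_eq_iff: "proj_point a 1 = proj_point b 1 \<longleftrightarrow> a = (b :: 'k::field)"
proof
  assume "proj_point a 1 = proj_point b 1"
  moreover have "(a, 1) \<in> proj_point a 1" by (auto simp: proj_point_def)
  ultimately show "a = b" by (auto simp: proj_point_def)
qed simp

text \<open>All representatives of the point at infinity have second coordinate 0.\<close>

lemma proj_point_finite_neq_infinity: "proj_point (a :: 'k::field) 1 \<noteq> proj_point 1 0"
proof
  assume "proj_point a 1 = proj_point 1 0"
  moreover have "(a, 1) \<in> proj_point a 1" by (auto simp: proj_point_def)
  ultimately show False by (auto simp: proj_point_def)
qed

lemma card_M_aff:
  "card (M_aff P Q) = (\<Sum>k\<in>UNIV. card {(x1, x2, y).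
     (poly P x1 * k + poly Q x1) * (poly P x2 * k + poly Q x2) = y ^ 2})"
  for P Q :: "'k::{field,finite} poly"
proof -
  let ?S = "\<lambda>k. {(x1, x2, y). (poly P x1 * k + poly Q x1) * (poly P x2 * k + poly Q x2) = y ^ 2}"
  have "M_aff P Q = (\<lambda>(k, x1, x2, y). (x1, x2, proj_point k 1, y)) ` Sigma UNIV ?S"
    by (force simp: M_aff_def image_iff)
  moreover have "inj_on (\<lambda>(k, x1, x2, y). (x1, x2, proj_point k 1, y)) (Sigma UNIV ?S)"
    by (auto simp: inj_on_def proj_point_finite_eq_iff)
  ultimately show ?thesis by (simp add: card_image)
qed

lemma card_M_infty:
  "card (M_infty P) = card {(x1, x2, y). poly P x1 * poly P x2 = y ^ 2}"
  for P :: "'k::{field,finite} poly"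
proof -
  have "M_infty P = (\<lambda>(x1, x2, y). (x1, x2, proj_point 1 0, y)) `
      {(x1, x2, y). poly P x1 * poly P x2 = y ^ 2}"
    by (force simp: M_infty_def image_iff)
  then show ?thesis by (simp add: card_image inj_on_def split_beta prod_eq_iff)
qed

text \<open>The q finite fibres contribute q^2 each, hence q^3, and the fibre at infinity
  contributes one more q^2; the squared traces make up \<open>M2_tilde\<close>.\<close>

lemma card_M_points:
  "int (card (M_points P Q)) = int CARD('k) ^ 3 + int CARD('k) ^ 2 + M2_tilde P Q"
  for P Q :: "'k::{field,finite} poly"
proof -
  have "M_aff P Q \<inter> M_infty P = {}"
    using proj_point_finite_neq_infinity by (auto simp: M_aff_def M_infty_def)
  then have "card (M_points P Q) = card (M_aff P Q) + card (M_infty P)"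
    by (simp add: M_points_def card_Un_disjoint)
  moreover have "int (card (M_aff P Q)) = (\<Sum>k\<in>UNIV. int CARD('k) ^ 2 + a_coeff P Q k ^ 2)"
    by (simp add: card_M_aff a_coeff_def card_surface[of "\<lambda>x. poly P x * _ + poly Q x"])
  moreover have "int (card (M_infty P)) = int CARD('k) ^ 2 + a_infty P ^ 2"
    by (simp add: card_M_infty a_infty_def card_surface)
  ultimately show ?thesis
    by (simp add: M2_tilde_def sum.distrib power2_eq_square power3_eq_cube)
qed

theorem theorem2p2:
  fixes P Q :: "int poly" and p r q :: nat
  assumes "degree P \<le> 3" and "degree Q \<le> 3"
    and "prime p" and "r \<ge> 1" and "q = p ^ r"
    and "CARD('k::{field,finite}) = q"
  shows "int (card (M_points (reduce P) (reduce Q :: 'k poly))) =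
    int q ^ 3 + int q ^ 2 + M2_tilde (reduce P) (reduce Q :: 'k poly)"
  using card_M_points[of "reduce P :: 'k poly" "reduce Q"] assms(6) by simp

end
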